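(* Let $\Bbbk$ be a field of characteristic zero and let $\psi_1,\psi_2$ be colourings of $\mathbb B$ with values in $\Bbbk[[h]]$. Assume that $\psi_1$ and $\psi_2$ satisfy the deformation axiom. Then: 1) The GQE equation $\mathscr E^{[-1]}_h(\psi_1,\psi_1)$ admits a solution if and only if $\psi_1$ is $h$-admissible. 2) If $\psi_1$ and $\psi_2$ are both $h$-admissible, then the GQE equation $\mathscr E^{[0]}_h(\psi_1,\psi_2)$ admits a solution.
   Context: Let $[E]=\{(n,k)\in\mathbb N^2 : 1\le k\le n\}$. A colouring of $\mathbb B$ with values in $\Bbbk[[h]]$ is a pair $\psi=(\psi^-,\psi^+)$ of functions $[E]\to\Bbbk[[h]]$. Its congruence class is the function $[\psi]:[E]\to\Bbbk[[h]]$, $[\psi](n,k)=\psi^-(n,k)\,\psi^+(n,n-k+1)$; write $[\psi](n,k)=\sum_{m\ge0}[\psi]_m(n,k)h^m$ with $[\psi]_m(n,k)\in\Bbbk$. For $P=\sum_m P_mh^m\in\Bbbk[u,v][[h]]$ and $n,k\in\mathbb Z$ put $P(n,k)=\sum_m P_m(n,k)h^m$; since a polynomial vanishing on $[E]$ is zero, $\Bbbk[u,v][[h]]$ is regarded as a subalgebra of the functions $[E]\to\Bbbk[[h]]$. The colouring $\psi$ is $h$-admissible if it satisfies: - (Deformation axiom) $[\psi]_0(n,k)=k(n-k+1)$ for all $(n,k)\in[E]$; - (Regularity axiom) $[\psi]\in\Bbbk[u,v][[h]]$; - (Quotient axiom) $[\psi](n,n+1)=0$ for all $n\in\mathbb N$;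 - (Verma axiom) $[\psi](-n-2,k)=[\psi](n,n+k+1)$ for all integers $n,k\ge1$ (the last two use the evaluation of the element of $\Bbbk[u,v][[h]]$ given by the regularity axiom). GQE equation. Let $d\in\mathbb Z$. A solution of the GQE equation $\mathscr E^{[d]}_h(\psi_1,\psi_2)$ is a sequence $M=(M_p)_{p\in\mathbb N}$ of elements of $\Bbbk[u][[h]]$ converging to $0$ in the $h$-adic topology, such that for all $p\in\mathbb N$ and $n\in\mathbb Z$ the following quantities are equal: (left) $\sum_{a=0}^{p}\Big(\prod_{k=p-a+1}^{p}[\psi_1](n,k)\Big)M_a(n-2p+2a)$ if $p\le n$, and $0$ if $p>n$; (right) $N_{p-d}(n)$ if $p\ge d$, and $0$ if $p<d$, where $N_r(n)=[\psi_2](n,r)$ if $0<r\le n$ and $N_r(n)=0$ otherwise. Here, for $P=\sum_m P_mh^m\in\Bbbk[u][[h]]$ and $n\in\mathbb Z$, $P(n)=\sum_m P_m(n)h^m$; empty products equal $1$. *)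

theory Defs
  imports "HOL-Computational_Algebra.Computational_Algebra"
begin

text \<open>
  \<open>\<k>[[h]]\<close>, \<open>\<k>[u][[h]]\<close> and \<open>\<k>[u,v][[h]]\<close> are \<open>'a fps\<close>, \<open>'a poly fps\<close> and \<open>'a poly poly fps\<close>.
  In \<open>\<k>[u,v] = \<k>[u][v]\<close> the outer polynomial variable is \<open>v\<close> and the inner one is \<open>u\<close>.
  The natural numbers include 0.
\<close>

definition E_set :: "(nat \<times> nat) set" where
  "E_set = {(n, k). 1 \<le> k \<and> k \<le> n}"

text \<open>
  A colouring is a pair of functions on \<open>E_set\<close>, encoded by total functions whose values outside
  \<open>E_set\<close> are never used: if \<open>(n, k)\<close> is in \<open>E_set\<close> then so is \<open>(n, n - k + 1)\<close>, and the congruence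
  class below is only ever evaluated at points of \<open>E_set\<close>.
\<close>

type_synonym 'a colouring = "(nat \<times> nat \<Rightarrow> 'a fps) \<times> (nat \<times> nat \<Rightarrow> 'a fps)"

definition cong_class :: "'a::field_char_0 colouring \<Rightarrow> nat \<times> nat \<Rightarrow> 'a fps" where
  "cong_class \<psi> = (\<lambda>(n, k). fst \<psi> (n, k) * snd \<psi> (n, n - k + 1))"

definition eval1 :: "'a::field_char_0 poly fps \<Rightarrow> int \<Rightarrow> 'a fps" where
  "eval1 P n = Abs_fps (\<lambda>m. poly (fps_nth P m) (of_int n))"

definition eval2 :: "'a::field_char_0 poly poly fps \<Rightarrow> int \<Rightarrow> int \<Rightarrow> 'a fps" where
  "eval2 P n k = Abs_fps (\<lambda>m. poly (poly (fps_nth P m) [:of_int k:]) (of_int n))"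

definition deformation_axiom :: "'a::field_char_0 colouring \<Rightarrow> bool" where
  "deformation_axiom \<psi> \<longleftrightarrow>
     (\<forall>(n, k)\<in>E_set. fps_nth (cong_class \<psi> (n, k)) 0 = of_nat (k * (n - k + 1)))"

text \<open>
  \<open>represents P \<psi>\<close>: the element \<open>P\<close> of \<open>\<k>[u,v][[h]]\<close>, regarded as a function on \<open>E_set\<close>, is the
  congruence class of \<open>\<psi>\<close>. There is at most one such \<open>P\<close>, because a polynomial vanishing on
  \<open>E_set\<close> is zero.
\<close>

definition represents :: "'a::field_char_0 poly poly fps \<Rightarrow> 'a colouring \<Rightarrow> bool" where
  "represents P \<psi> \<longleftrightarrow> (\<forall>(n, k)\<in>E_set. cong_class \<psi> (n, k) = eval2 P (int n) (int k))"

definition quotient_axiom :: "'a::field_char_0 poly poly fps \<Rightarrow> bool" where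
  "quotient_axiom P \<longleftrightarrow> (\<forall>n::nat. eval2 P (int n) (int n + 1) = 0)"

definition verma_axiom :: "'a::field_char_0 poly poly fps \<Rightarrow> bool" where
  "verma_axiom P \<longleftrightarrow>
     (\<forall>n k :: int. n \<ge> 1 \<longrightarrow> k \<ge> 1 \<longrightarrow> eval2 P (- n - 2) k = eval2 P n (n + k + 1))"

text \<open>
  The existence of \<open>P\<close> is the regularity axiom; by its uniqueness, the quotient and Verma axioms are
  conditions on \<open>\<psi>\<close>.
\<close>

definition h_admissible :: "'a::field_char_0 colouring \<Rightarrow> bool" where
  "h_admissible \<psi> \<longleftrightarrow>
     deformation_axiom \<psi> \<and> (\<exists>P. represents P \<psi> \<and> quotient_axiom P \<and> verma_axiom P)"

definition GQE_left :: "'a::field_char_0 colouring \<Rightarrow> (nat \<Rightarrow> 'a poly fps) \<Rightarrow> nat \<Rightarrow> int \<Rightarrow> 'a fps" where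
  "GQE_left \<psi> M p n =
     (if int p \<le> n
      then \<Sum>a = 0..p. (\<Prod>k = p - a + 1..p. cong_class \<psi> (nat n, k)) *
                        eval1 (M a) (n - 2 * int p + 2 * int a)
      else 0)"

definition GQE_N :: "'a::field_char_0 colouring \<Rightarrow> int \<Rightarrow> int \<Rightarrow> 'a fps" where
  "GQE_N \<psi> r n = (if 0 < r \<and> r \<le> n then cong_class \<psi> (nat n, nat r) else 0)"

definition GQE_right :: "int \<Rightarrow> 'a::field_char_0 colouring \<Rightarrow> nat \<Rightarrow> int \<Rightarrow> 'a fps" where
  "GQE_right d \<psi> p n = (if int p \<ge> d then GQE_N \<psi> (int p - d) n else 0)"

text \<open>The library's metric on formal power series induces the \<open>h\<close>-adic topology.\<close>

definition GQE_solution ::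
  "int \<Rightarrow> 'a::field_char_0 colouring \<Rightarrow> 'a colouring \<Rightarrow> (nat \<Rightarrow> 'a poly fps) \<Rightarrow> bool" where
  "GQE_solution d \<psi>\<^sub>1 \<psi>\<^sub>2 M \<longleftrightarrow>
     M \<longlonglongrightarrow> 0 \<and> (\<forall>(p::nat) (n::int). GQE_left \<psi>\<^sub>1 M p n = GQE_right d \<psi>\<^sub>2 p n)"

end

(*
  The map (n, p) |-> (-n-2, p-n-1) of the Verma axiom is the dot action of the Weyl group of sl_2:
  by the Verma and quotient axioms a colouring is h-admissible iff its congruence class, extended by
  zero to p = 0 and p = n+1, is an invariant series. Modulo h, the left side of the GQE equation is
  triangular in powers of p(n-p+1) over polynomials in n-2p, and these generate the invariants. Hence
  an admissible psi_1 allows every invariant right side, by successive approximation in h. Conversely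
  a solution of E^[-1] determines [psi] order by order: each coefficient is the discrete
  antiderivative in p of an invariant polynomial, hence a polynomial, and its vanishing on both
  boundary lines makes it invariant again.
*)

theory Submission
  imports Defs
begin

section \<open>Polynomial functions of two integer variables\<close>

text \<open>Phrased for functions on pairs of integers, so that substitutions such as the reflection
  are plain composition.\<close>

definition bipoly :: "(int \<Rightarrow> int \<Rightarrow> 'a::field_char_0) \<Rightarrow> bool" where
  "bipoly F \<longleftrightarrow> (\<exists>P. \<forall>n p. F n p = poly (poly P [:of_int p:]) (of_int n))"

lemma bipolyI: "(\<And>n p. F n p = poly (poly P [:of_int p:]) (of_int n)) \<Longrightarrow> bipoly F"
  unfolding bipoly_def by blast

lemma bipoly_const: "bipoly (\<lambda>n p. c)"
  by (rule bipolyI[of _ "[:[:c:]:]"]) simp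

lemma bipoly_fst: "bipoly (\<lambda>n p. of_int n)"
  by (rule bipolyI[of _ "[:[:0, 1:]:]"]) simp

lemma bipoly_snd: "bipoly (\<lambda>n p. of_int p)"
  by (rule bipolyI[of _ "[:0, 1:]"]) simp

lemma bipoly_add:
  assumes "bipoly F" "bipoly G"
  shows "bipoly (\<lambda>n p. F n p + G n p)"
proof -
  obtain P Q where "\<And>n p. F n p = poly (poly P [:of_int p:]) (of_int n)"
    "\<And>n p. G n p = poly (poly Q [:of_int p:]) (of_int n)"
    using assms unfolding bipoly_def by metis
  then show ?thesis by (intro bipolyI[of _ "P + Q"]) simp
qed

lemma bipoly_mult:
  assumes "bipoly F" "bipoly G"
  shows "bipoly (\<lambda>n p. F n p * G n p)"
proof -
  obtain P Q where "\<And>n p. F n p = poly (poly P [:of_int p:]) (of_int n)"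
    "\<And>n p. G n p = poly (poly Q [:of_int p:]) (of_int n)"
    using assms unfolding bipoly_def by metis
  then show ?thesis by (intro bipolyI[of _ "P * Q"]) simp
qed

lemma bipoly_uminus: "bipoly F \<Longrightarrow> bipoly (\<lambda>n p. - F n p)"
  using bipoly_mult[OF bipoly_const[of "-1"]] by simp

lemma bipoly_diff: "bipoly F \<Longrightarrow> bipoly G \<Longrightarrow> bipoly (\<lambda>n p. F n p - G n p)"
  using bipoly_add[OF _ bipoly_uminus] by simp

lemma bipoly_sum: "(\<And>i. i \<in> A \<Longrightarrow> bipoly (F i)) \<Longrightarrow> bipoly (\<lambda>n p. \<Sum>i\<in>A. F i n p)"
  by (induction A rule: infinite_finite_induct) (simp_all add: bipoly_const bipoly_add)

lemma bipoly_poly: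
  assumes "bipoly F"
  shows "bipoly (\<lambda>n p. poly q (F n p))"
  by (induction q) (simp_all add: bipoly_const bipoly_add bipoly_mult assms)

lemma bipoly_compose:
  assumes "bipoly F" "bipoly (\<lambda>n p. of_int (a n p) :: 'a)" "bipoly (\<lambda>n p. of_int (b n p) :: 'a)"
  shows "bipoly (\<lambda>n p. F (a n p) (b n p) :: 'a::field_char_0)"
proof -
  obtain P where P: "\<And>n p. F n p = poly (poly P [:of_int p:]) (of_int n)"
    using assms(1) unfolding bipoly_def by blast
  have "bipoly (\<lambda>n p. poly (poly P [:of_int (b n p):]) (of_int (a n p)))"
    by (induction P)
      (simp_all add: bipoly_const bipoly_add bipoly_mult bipoly_poly assms(2,3))
  then show ?thesis by (simp add: P)
qed

lemmas bipoly_intros = bipoly_const bipoly_fst bipoly_snd bipoly_add bipoly_mult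
  bipoly_uminus bipoly_diff

text \<open>A nonzero polynomial over a domain has finitely many roots. The generality allows
  coefficients in \<open>'a\<close> as well as in \<open>'a poly\<close>, which are the two layers
  of a polynomial in two variables.\<close>

lemma poly_eq_0_if_eventually_0:
  fixes q :: "'b::idom poly"
  assumes "inj f" "\<And>n::nat. n \<ge> N \<Longrightarrow> poly q (f n) = 0"
  shows "q = 0"
proof (rule ccontr)
  assume "q \<noteq> 0"
  then have "finite {x. poly q x = 0}" by (rule poly_roots_finite)
  moreover have "f ` {N..} \<subseteq> {x. poly q x = 0}" using assms(2) by auto
  ultimately have "finite (f ` {N..})" by (rule rev_finite_subset)
  then show False
    using finite_imageD[of f "{N..}"] inj_on_subset[OF assms(1)] infinite_Ici by blast
qed

text \<open>Density of the triangle 1 <= p <= n: for fixed p all n >= p are roots in the inner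
  variable, and then all p >= 1 are roots in the outer one.\<close>

lemma bipoly_eq_0:
  assumes "bipoly F" "\<And>n p. 1 \<le> p \<Longrightarrow> p \<le> n \<Longrightarrow> F n p = 0"
  shows "F n p = 0"
proof -
  obtain P where P: "\<And>n p. F n p = poly (poly P [:of_int p:]) (of_int n)"
    using assms(1) unfolding bipoly_def by blast
  have *: "poly P [:of_int (int p):] = 0" if "p \<ge> 1" for p
  proof (rule poly_eq_0_if_eventually_0[of "\<lambda>n. of_int (int n)" p])
    show "inj (\<lambda>n. of_int (int n) :: 'a)" by (auto simp: inj_def)
    show "poly (poly P [:of_int (int p):]) (of_int (int n)) = 0" if "p \<le> n" for n
      using assms(2)[of "int p" "int n"] that \<open>p \<ge> 1\<close> P by simp
  qed
  have "P = 0"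
    by (rule poly_eq_0_if_eventually_0[of "\<lambda>p. [:of_int (int p):]" 1]) (use * in \<open>auto simp: inj_def\<close>)
  then show ?thesis by (simp add: P)
qed

lemma bipoly_eqI:
  assumes "bipoly F" "bipoly G" "\<And>n p. 1 \<le> p \<Longrightarrow> p \<le> n \<Longrightarrow> F n p = G n p"
  shows "F n p = G n p"
  using bipoly_eq_0[OF bipoly_diff[OF assms(1,2)]] assms(3) by simp

section \<open>Polynomials invariant under the dot action\<close>

text \<open>
  The reflection \<open>(n, p) \<mapsto> (-n-2, p-n-1)\<close> behind the Verma axiom fixes \<open>n - 2 p\<close> and
  \<open>p (n - p + 1)\<close>; by \<open>inv_bipolyI\<close> below these two generate all the invariants.
\<close>

definition inv_bipoly :: "(int \<Rightarrow> int \<Rightarrow> 'a::field_char_0) \<Rightarrow> bool" where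
  "inv_bipoly F \<longleftrightarrow> (\<exists>G. bipoly G \<and> (\<forall>n p. F n p = G (n - 2 * p) (p * (n - p + 1))))"

lemma inv_bipoly_imp_bipoly:
  assumes "inv_bipoly F"
  shows "bipoly F"
proof -
  obtain G where G: "bipoly G" "\<And>n p. F n p = G (n - 2 * p) (p * (n - p + 1))"
    using assms unfolding inv_bipoly_def by blast
  have "bipoly (\<lambda>n p. G (n - 2 * p) (p * (n - p + 1)))"
    using G(1) by (rule bipoly_compose) (simp_all add: bipoly_intros)
  then show ?thesis unfolding G(2)[abs_def, symmetric] .
qed

lemma inv_bipoly_reflect:
  assumes "inv_bipoly F"
  shows "F (- n - 2) (p - n - 1) = F n p"
proof -
  obtain G where G: "bipoly G" "\<And>n p. F n p = G (n - 2 * p) (p * (n - p + 1))"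
    using assms unfolding inv_bipoly_def by blast
  have "- n - 2 - 2 * (p - n - 1) = n - 2 * p"
    "(p - n - 1) * (- n - 2 - (p - n - 1) + 1) = p * (n - p + 1)"
    by algebra+
  then show ?thesis by (simp only: G(2))
qed

lemma inv_bipoly_const: "inv_bipoly (\<lambda>n p. c)"
  unfolding inv_bipoly_def using bipoly_const by blast

lemma inv_bipoly_add:
  assumes "inv_bipoly F" "inv_bipoly G"
  shows "inv_bipoly (\<lambda>n p. F n p + G n p)"
proof -
  obtain F' G' where "bipoly F'" "\<And>n p. F n p = F' (n - 2 * p) (p * (n - p + 1))"
    "bipoly G'" "\<And>n p. G n p = G' (n - 2 * p) (p * (n - p + 1))"
    using assms unfolding inv_bipoly_def by metis
  then show ?thesis unfolding inv_bipoly_def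
    by (intro exI[of _ "\<lambda>n p. F' n p + G' n p"]) (simp add: bipoly_add)
qed

lemma inv_bipoly_mult:
  assumes "inv_bipoly F" "inv_bipoly G"
  shows "inv_bipoly (\<lambda>n p. F n p * G n p)"
proof -
  obtain F' G' where "bipoly F'" "\<And>n p. F n p = F' (n - 2 * p) (p * (n - p + 1))"
    "bipoly G'" "\<And>n p. G n p = G' (n - 2 * p) (p * (n - p + 1))"
    using assms unfolding inv_bipoly_def by metis
  then show ?thesis unfolding inv_bipoly_def
    by (intro exI[of _ "\<lambda>n p. F' n p * G' n p"]) (simp add: bipoly_mult)
qed

lemma inv_bipoly_sum:
  "(\<And>i. i \<in> A \<Longrightarrow> inv_bipoly (F i)) \<Longrightarrow> inv_bipoly (\<lambda>n p. \<Sum>i\<in>A. F i n p)"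
  by (induction A rule: infinite_finite_induct) (simp_all add: inv_bipoly_const inv_bipoly_add)

lemma inv_bipoly_diff:
  "inv_bipoly F \<Longrightarrow> inv_bipoly G \<Longrightarrow> inv_bipoly (\<lambda>n p. F n p - G n p)"
  using inv_bipoly_add[OF _ inv_bipoly_mult[OF inv_bipoly_const[of "-1"]]] by simp

lemma inv_bipoly_weight: "inv_bipoly (\<lambda>n p. poly q (of_int (n - 2 * p + 2 * c)))"
  unfolding inv_bipoly_def
  by (intro exI[of _ "\<lambda>x z. poly q (of_int (x + 2 * c))"])
    (simp_all add: bipoly_poly bipoly_intros)

text \<open>The shift in p commutes with the reflection. On the generators x = n - 2 p and z = p (n
  - p + 1) it is x -> x + 2 j, z -> z - j x - j (j + 1).\<close>

lemma inv_bipoly_shift: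
  assumes "inv_bipoly F"
  shows "inv_bipoly (\<lambda>n p. F n (p - j))"
proof -
  obtain G where G: "bipoly G" "\<And>n p. F n p = G (n - 2 * p) (p * (n - p + 1))"
    using assms unfolding inv_bipoly_def by blast
  have *: "n - 2 * (p - j) = n - 2 * p + 2 * j"
    "(p - j) * (n - (p - j) + 1) = p * (n - p + 1) - j * (n - 2 * p) - j * (j + 1)" for n p :: int
    by algebra+
  have "bipoly (\<lambda>x z. G (x + 2 * j) (z - j * x - j * (j + 1)))"
    using G(1) by (rule bipoly_compose) (simp_all add: bipoly_intros)
  then show ?thesis unfolding inv_bipoly_def G(2) * by blast
qed

text \<open>In the coordinates x = n - 2 p (inner) and v = p (outer) the reflection is v -> -1 - x -
  v, and p (n - p + 1) becomes v (v + x + 1). An invariant Q takes the value Q(0) at v = 0 and at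
  its image v = -1 - x, so Q - Q(0) is divisible by v (v + x + 1). The quotient is invariant of
  smaller degree.\<close>

lemma reflection_invariant_poly:
  fixes Q :: "'a::field_char_0 poly poly"
  assumes "pcompose Q [:[:-1, -1:], -1:] = Q"
  shows "\<exists>R. Q = pcompose R [:0, [:1, 1:], 1:]"
  using assms
proof (induction "degree Q" arbitrary: Q rule: less_induct)
  case (less Q)
  let ?r = "[:[:-1, -1:], -1:] :: 'a poly poly"
  let ?z = "[:0, [:1, 1:], 1:] :: 'a poly poly"
  show ?case
  proof (cases "degree Q = 0")
    case True
    then obtain q where "Q = [:q:]" by (metis degree_eq_zeroE)
    then show ?thesis by (intro exI[of _ "[:q:]"]) simp
  next
    case False
    obtain q Q1 where Q: "Q = pCons q Q1" by (cases Q)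
    have "poly Q (poly ?r 0) = poly Q 0" using less.prems by (metis poly_pcompose)
    moreover have "poly ?r 0 = [:-1, -1:]" by simp
    ultimately have "[:-1, -1:] * poly Q1 [:-1, -1:] = 0"
      by (simp only: Q poly_pCons mult_zero_left add_0_right add_cancel_left_right)
    then have "poly Q1 [:-1, -1:] = 0" by (subst (asm) mult_eq_0_iff) auto
    then have "[:- [:-1, -1:], 1:] dvd Q1" by (simp only: poly_eq_0_iff_dvd)
    then have "[:[:1, 1:], 1:] dvd Q1" by simp
    then obtain Q2 where Q1: "Q1 = [:[:1, 1:], 1:] * Q2" by (elim dvdE)
    have Qz: "Q = [:q:] + ?z * Q2"
      by (simp add: Q Q1 algebra_simps)
    have "pcompose ?z ?r = ?z" by (simp add: pcompose_pCons)
    then have "?z * pcompose Q2 ?r = ?z * Q2"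
      using less.prems by (simp only: Qz pcompose_add pcompose_mult pcompose_const add_left_cancel)
    then have Q2: "pcompose Q2 ?r = Q2"
      by (subst (asm) mult_cancel_left) auto
    have "degree Q2 < degree Q"
    proof (cases "Q2 = 0")
      case True then show ?thesis using False by simp
    next
      case nz: False
      have "degree Q1 = 1 + degree Q2" unfolding Q1 using nz by (subst degree_mult_eq) auto
      then show ?thesis unfolding Q by (cases "Q1 = 0") auto
    qed
    from less.hyps[OF this Q2] obtain R where "Q2 = pcompose R ?z" by blast
    then have "Q = pcompose (pCons q R) ?z"
      by (simp only: Qz pcompose_pCons)
    then show ?thesis by blast
  qed
qed

lemma inv_bipolyI:
  assumes F: "bipoly F" and refl: "\<And>n k. n \<ge> 1 \<Longrightarrow> k \<ge> 1 \<Longrightarrow> F (- n - 2) k = F n (n + k + 1)"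
  shows "inv_bipoly F"
proof -
  have "F (- n - 2) k = F n (n + k + 1)" for n k
  proof (rule bipoly_eqI[where F = "\<lambda>n k. F (- n - 2) k" and G = "\<lambda>n k. F n (n + k + 1)"])
    show "bipoly (\<lambda>n k. F (- n - 2) k)"
      using F by (rule bipoly_compose) (simp_all add: bipoly_intros)
    show "bipoly (\<lambda>n k. F n (n + k + 1))"
      using F by (rule bipoly_compose) (simp_all add: bipoly_intros)
  qed (use refl in simp)
  \<comment> \<open>Setting k = p - n - 1 turns the Verma form of the symmetry into the
    reflection.\<close>
  then have refl': "F (- n - 2) (p - n - 1) = F n p" for n p
    by (metis add.commute add_diff_cancel_left' diff_add_cancel diff_diff_eq)
  have "bipoly (\<lambda>x v. F (x + 2 * v) v)"
    using F by (rule bipoly_compose) (simp_all add: bipoly_intros)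
  then obtain Q where Q: "\<And>x v. F (x + 2 * v) v = poly (poly Q [:of_int v:]) (of_int x)"
    unfolding bipoly_def by blast
  \<comment> \<open>Substituting a polynomial g for the outer variable and then x for the inner one
    only uses the value of g at x.\<close>
  have nest: "poly (poly S g) x = poly (poly S [:poly g x:]) x" for S g and x :: 'a
    by (induction S) simp_all
  let ?D = "pcompose Q [:[:-1, -1:], -1:] - Q"
  have "poly (poly ?D [:of_int v:]) (of_int x) = 0" for x v
  proof -
    have "poly (poly (pcompose Q [:[:-1, -1:], -1:]) [:of_int v:]) (of_int x)
        = poly (poly Q [:of_int (- 1 - (v + x)):]) (of_int x)"
      by (subst poly_pcompose, subst nest) (simp add: algebra_simps)
    also have "\<dots> = F (x + 2 * (- 1 - (v + x))) (- 1 - (v + x))" by (simp only: Q)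
    also have "\<dots> = F (- (x + 2 * v) - 2) (v - (x + 2 * v) - 1)"
      by (rule arg_cong2[where f = F]) simp_all
    also have "\<dots> = F (x + 2 * v) v" by (rule refl')
    finally show ?thesis by (simp add: Q)
  qed
  note D0 = this
  have "poly ?D [:of_int (int v):] = 0" for v
    by (rule poly_eq_0_if_eventually_0[of "\<lambda>n. of_int (int n)" 0])
      (simp add: inj_def, rule D0)
  then have "?D = 0"
    by (intro poly_eq_0_if_eventually_0[of "\<lambda>p. [:of_int (int p):]" 0]) (auto simp: inj_def)
  then obtain R where R: "Q = pcompose R [:0, [:1, 1:], 1:]"
    using reflection_invariant_poly[of Q] by auto
  have "F n p = poly (poly R [:of_int (p * (n - p + 1)):]) (of_int (n - 2 * p))" for n p
  proof -
    have "F n p = poly (poly Q [:of_int p:]) (of_int (n - 2 * p))"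
      using Q[of "n - 2 * p" p] by simp
    also have "\<dots> = poly (poly R [:of_int (p * (n - p + 1)):]) (of_int (n - 2 * p))"
      unfolding R by (subst poly_pcompose, subst nest) (simp add: algebra_simps)
    finally show ?thesis .
  qed
  then show ?thesis unfolding inv_bipoly_def bipoly_def
    by (intro exI[of _ "\<lambda>x z. poly (poly R [:of_int z:]) (of_int x)"]) auto
qed

section \<open>Discrete antiderivatives\<close>

text \<open>Faulhaber's recursion: the difference of x^(k+1) is (k+1) x^k plus lower powers, whose
  antidifferences are known; characteristic zero permits the division by k+1.\<close>

lemma power_antidifference:
  "\<exists>s :: 'a::field_char_0 poly. poly s 0 = 0 \<and> (\<forall>x. poly s (x + 1) - poly s x = x ^ k)"
proof (induction k rule: less_induct)
  case (less k)
  then obtain s :: "nat \<Rightarrow> 'a poly" where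
    s: "\<And>i. i < k \<Longrightarrow> poly (s i) 0 = 0" "\<And>i x. i < k \<Longrightarrow> poly (s i) (x + 1) - poly (s i) x = x ^ i"
    by metis
  define t where "t = smult (1 / of_nat (Suc k))
    (monom 1 (Suc k) - (\<Sum>i<k. smult (of_nat (Suc k choose i)) (s i)))"
  have "poly t (x + 1) - poly t x = x ^ k" for x
  proof -
    have "of_nat (Suc k) * (poly t (x + 1) - poly t x) = (x + 1) ^ Suc k - x ^ Suc k
        - (\<Sum>i<k. of_nat (Suc k choose i) * (poly (s i) (x + 1) - poly (s i) x))"
      unfolding t_def
      by (simp add: poly_monom poly_sum sum_subtractf right_diff_distrib del: of_nat_Suc power_Suc)
    also have "\<dots> = (x + 1) ^ Suc k - x ^ Suc k - (\<Sum>i<k. of_nat (Suc k choose i) * x ^ i)"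
      using s(2) by simp
    also have "(x + 1) ^ Suc k = (\<Sum>i\<le>Suc k. of_nat (Suc k choose i) * x ^ i)"
      by (subst binomial_ring) simp
    also have "\<dots> = (\<Sum>i<k. of_nat (Suc k choose i) * x ^ i) + of_nat (Suc k) * x ^ k + x ^ Suc k"
      by (simp add: lessThan_Suc_atMost[symmetric] del: of_nat_Suc power_Suc binomial_Suc_Suc)
    finally have "of_nat (Suc k) * (poly t (x + 1) - poly t x) = of_nat (Suc k) * x ^ k"
      by simp
    then show ?thesis by (simp del: of_nat_Suc)
  qed
  moreover have "poly t 0 = 0" by (simp add: t_def poly_monom poly_sum s(1))
  ultimately show ?case by blast
qed

lemma bipoly_antidifference:
  fixes D :: "int \<Rightarrow> int \<Rightarrow> 'a::field_char_0"
  assumes "bipoly D"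
  obtains S where "bipoly S" "\<And>n. S n 0 = 0" "\<And>n p. S n (p + 1) = S n p + D n p"
proof -
  obtain P where P: "\<And>n p. D n p = poly (poly P [:of_int p:]) (of_int n)"
    using assms unfolding bipoly_def by blast
  obtain s :: "nat \<Rightarrow> 'a poly" where
    s: "\<And>i. poly (s i) 0 = 0" "\<And>i x. poly (s i) (x + 1) - poly (s i) x = x ^ i"
    using power_antidifference by metis
  define S where
    "S n p = (\<Sum>i\<le>degree P. poly (coeff P i) (of_int n) * poly (s i) (of_int p))" for n p
  have "S n (p + 1) - S n p = D n p" for n p
  proof -
    have "S n (p + 1) - S n p = (\<Sum>i\<le>degree P. poly (coeff P i) (of_int n) *
        (poly (s i) (of_int p + 1) - poly (s i) (of_int p)))"
      by (simp add: S_def sum_subtractf right_diff_distrib)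
    also have "\<dots> = (\<Sum>i\<le>degree P. poly (coeff P i) (of_int n) * of_int p ^ i)"
      by (simp only: s(2))
    also have "\<dots> = D n p"
      by (simp only: P poly_altdef[of P] poly_sum poly_mult poly_power poly_pCons poly_0
          mult_zero_right add_0_right)
    finally show ?thesis .
  qed
  then have "S n (p + 1) = S n p + D n p" for n p by (metis add.commute diff_add_cancel)
  moreover have "bipoly S" unfolding S_def
    by (intro bipoly_sum bipoly_mult bipoly_poly bipoly_fst bipoly_snd)
  moreover have "S n 0 = 0" for n by (simp add: S_def s(1))
  ultimately show ?thesis using that by blast
qed

text \<open>Since D is invariant, S minus its reflection does not change under p -> p + 1. At p = n
  + 1 both terms vanish, because the reflection exchanges the lines p = n + 1 and p = 0; so the
  difference is zero everywhere.\<close>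

lemma inv_bipoly_antidifference:
  fixes D :: "int \<Rightarrow> int \<Rightarrow> 'a::field_char_0"
  assumes D: "inv_bipoly D" and S: "bipoly S" "\<And>n. S n 0 = 0" "\<And>n p. S n (p + 1) = S n p + D n p"
    and top: "\<And>n. n \<ge> 0 \<Longrightarrow> S n (n + 1) = 0"
  shows "inv_bipoly S"
proof -
  \<comment> \<open>The reflection leads to negative n, so the vanishing at p = n + 1 is first
    extended to all integers n by density.\<close>
  have "bipoly (\<lambda>n p. S n (n + 1))"
    using S(1) by (rule bipoly_compose) (simp_all add: bipoly_intros)
  then have top': "S n (n + 1) = 0" for n
    by (rule bipoly_eq_0[where F = "\<lambda>n p. S n (n + 1)"]) (simp add: top)
  define \<Delta> where "\<Delta> n p = S n p - S (- n - 2) (p - n - 1)" for n p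
  have step: "\<Delta> n (p + 1) = \<Delta> n p" for n p
    using S(3)[of n p] S(3)[of "- n - 2" "p - n - 1"] inv_bipoly_reflect[OF D, of n p]
    by (simp add: \<Delta>_def algebra_simps)
  have "\<Delta> n p = \<Delta> n (n + 1)" for n p
  proof (induction p rule: int_induct[where k = "n + 1"])
    case (step1 i) then show ?case by (simp add: step)
  next
    case (step2 i) then show ?case using step[of n "i - 1"] by simp
  qed simp
  also have "\<Delta> n (n + 1) = 0" for n by (simp add: \<Delta>_def top' S(2))
  finally have refl: "S (- n - 2) (p - n - 1) = S n p" for n p by (simp add: \<Delta>_def)
  show ?thesis
  proof (rule inv_bipolyI[OF S(1)])
    show "S (- n - 2) k = S n (n + k + 1)" for n k using refl[of n "n + k + 1"] by simp
  qed
qed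

section \<open>Triangular expansions of invariants\<close>

text \<open>The coefficient of \<open>M a\<close> in the left side of the equation. The value type
  is generic so that it covers both power series and their constant terms.\<close>

definition falling :: "(int \<Rightarrow> int \<Rightarrow> 'b::comm_monoid_mult) \<Rightarrow> nat \<Rightarrow> int \<Rightarrow> int \<Rightarrow> 'b" where
  "falling C a n p = (\<Prod>j<a. C n (p - int j))"

lemma falling_0 [simp]: "falling C 0 n p = 1"
  and falling_Suc: "falling C (Suc a) n p = falling C a n p * C n (p - int a)"
  by (simp_all add: falling_def)

text \<open>For a > k the product contains the factor C(n, 0). This makes the system triangular: a
  sum over many a stops at a = k when p = k.\<close>

lemma falling_eq_0:
  fixes C :: "int \<Rightarrow> int \<Rightarrow> 'b::comm_semiring_1"
  assumes "C n 0 = 0" "k < a"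
  shows "falling C a n (int k) = 0"
  unfolding falling_def by (rule prod_zero) (use assms in \<open>auto intro!: bexI[of _ k]\<close>)

text \<open>The scalar by which f e acts on f^p v in the Verma module of sl_2 with highest weight
  vector v of weight n; also the value that the deformation axiom prescribes.\<close>

abbreviation (input) casimir :: "int \<Rightarrow> int \<Rightarrow> 'a::field_char_0" where
  "casimir n p \<equiv> of_int (p * (n - p + 1))"

text \<open>The left side of the equation modulo h, with one bound \<open>N\<close> for all n and p.
  The bound is what later makes \<open>M\<close> converge h-adically.\<close>

definition has_expansion :: "(int \<Rightarrow> int \<Rightarrow> 'a::field_char_0) \<Rightarrow> bool" where
  "has_expansion F \<longleftrightarrow> (\<exists>N m. (\<forall>a\<ge>N. m a = 0) \<and>
     (\<forall>n p. F n p = (\<Sum>a<N. falling casimir a n p * poly (m a) (of_int (n - 2 * p + 2 * int a)))))"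

lemma has_expansion_single:
  "has_expansion (\<lambda>n p. falling casimir a n p * poly g (of_int (n - 2 * p + 2 * int a)))"
  unfolding has_expansion_def
  by (intro exI[of _ "Suc a"] exI[of _ "\<lambda>i. if i = a then g else 0"])
    (simp add: if_distrib[of "\<lambda>q. poly q _"] if_distrib[of "(*) _"] cong: if_cong)

lemma has_expansion_add:
  assumes "has_expansion F" "has_expansion G"
  shows "has_expansion (\<lambda>n p. F n p + G n p)"
proof -
  have pad: "(\<Sum>a<N. falling casimir a n p * poly (m a) (f a)) =
      (\<Sum>a<max N N'. falling casimir a n p * poly (m a) (f a))"
    if "\<forall>a\<ge>N. m a = 0" for N N' n p f and m :: "nat \<Rightarrow> 'a poly"
    by (rule sum.mono_neutral_left) (use that in auto)
  obtain N m where m: "\<forall>a\<ge>N. m a = 0"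
    "\<And>n p. F n p = (\<Sum>a<N. falling casimir a n p * poly (m a) (of_int (n - 2 * p + 2 * int a)))"
    using assms(1) unfolding has_expansion_def by blast
  obtain N' m' where m': "\<forall>a\<ge>N'. m' a = 0"
    "\<And>n p. G n p = (\<Sum>a<N'. falling casimir a n p * poly (m' a) (of_int (n - 2 * p + 2 * int a)))"
    using assms(2) unfolding has_expansion_def by blast
  have "F n p + G n p = (\<Sum>a<max N N'. falling casimir a n p *
      poly (m a + m' a) (of_int (n - 2 * p + 2 * int a)))" for n p
    unfolding m(2) m'(2) pad[OF m(1), of _ _ _ N'] pad[OF m'(1), of _ _ _ N] max.commute[of N' N]
      poly_add distrib_left[of "falling _ _ _ _"] sum.distrib ..
  then show ?thesis unfolding has_expansion_def
    using m(1) m'(1) by (intro exI[of _ "max N N'"] exI[of _ "\<lambda>a. m a + m' a"] conjI) auto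
qed

lemma has_expansion_sum:
  "(\<And>i. i \<in> A \<Longrightarrow> has_expansion (F i)) \<Longrightarrow> has_expansion (\<lambda>n p. \<Sum>i\<in>A. F i n p)"
proof (induction A rule: infinite_finite_induct)
  case (insert x A) then show ?case by (simp add: has_expansion_add)
qed (use has_expansion_single[of 0 0] in simp_all)

lemma has_expansion_casimir_mult:
  assumes "has_expansion F"
  shows "has_expansion (\<lambda>n p. casimir n p * F n p)"
proof -
  obtain N and m :: "nat \<Rightarrow> 'a poly" where m:
    "\<And>n p. F n p = (\<Sum>a<N. falling casimir a n p * poly (m a) (of_int (n - 2 * p + 2 * int a)))"
    using assms unfolding has_expansion_def by blast
  \<comment> \<open>With w = n - 2 p + 2 a, the value of \<open>casimir\<close> at p is its value at
    p - a plus a w + a (1 - a). The first summand lengthens the falling product and raises the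
    weight by 2, which \<open>A\<close> undoes; the rest is absorbed by \<open>B\<close>.\<close>
  define A :: "nat \<Rightarrow> 'a poly" where "A a = pcompose (m a) [:-2, 1:]" for a
  define B :: "nat \<Rightarrow> 'a poly" where "B a = [:of_nat a * (1 - of_nat a), of_nat a:] * m a" for a
  have "casimir n p * (falling casimir a n p * poly (m a) (of_int (n - 2 * p + 2 * int a)))
      = falling casimir (Suc a) n p * poly (A a) (of_int (n - 2 * p + 2 * int (Suc a)))
        + falling casimir a n p * poly (B a) (of_int (n - 2 * p + 2 * int a))" for a n p
  proof -
    have "poly (A a) (of_int (n - 2 * p + 2 * int (Suc a)))
        = poly (m a) (of_int (n - 2 * p + 2 * int a))"
      unfolding A_def poly_pcompose by (rule arg_cong[of _ _ "poly (m a)"]) simp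
    then show ?thesis by (simp add: falling_Suc B_def algebra_simps)
  qed
  then have "casimir n p * F n p = (\<Sum>a<N.
      falling casimir (Suc a) n p * poly (A a) (of_int (n - 2 * p + 2 * int (Suc a)))
        + falling casimir a n p * poly (B a) (of_int (n - 2 * p + 2 * int a)))" for n p
    by (simp only: m sum_distrib_left)
  then show ?thesis
    by (simp only: has_expansion_sum has_expansion_add has_expansion_single)
qed

text \<open>Horner's scheme in the generator p (n - p + 1), with coefficients polynomial in n - 2
  p.\<close>

lemma inv_bipoly_imp_has_expansion:
  assumes "inv_bipoly F"
  shows "has_expansion F"
proof -
  obtain P where P: "\<And>n p. F n p = poly (poly P [:casimir n p:]) (of_int (n - 2 * p))"
    using assms unfolding inv_bipoly_def bipoly_def by metis
  have "has_expansion (\<lambda>n p. poly (poly P [:casimir n p:]) (of_int (n - 2 * p)))"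
  proof (induction P)
    case 0 then show ?case using has_expansion_single[of 0 0] by simp
  next
    case (pCons q P)
    have "has_expansion (\<lambda>n p. poly q (of_int (n - 2 * p)))"
      using has_expansion_single[of 0 q] by simp
    from has_expansion_add[OF this has_expansion_casimir_mult[OF pCons.IH]]
    show ?case by (simp only: poly_pCons poly_add poly_mult poly_0 mult_zero_right add_0_right)
  qed
  then show ?thesis unfolding P[abs_def, symmetric] .
qed

text \<open>In row k the last term is \<open>m k\<close> evaluated at n, times a product that is
  nonzero for n >= k. Once the earlier \<open>m a\<close> vanish, \<open>m k\<close> has infinitely
  many roots.\<close>

lemma expansion_unique:
  fixes m :: "nat \<Rightarrow> 'a::field_char_0 poly"
  assumes "\<And>n k. int k \<le> n \<Longrightarrow>
    (\<Sum>a\<le>k. falling casimir a n (int k) * poly (m a) (of_int (n - 2 * int k + 2 * int a))) = 0"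
  shows "m k = 0"
proof (induction k rule: less_induct)
  case (less k)
  have "poly (m k) (of_int (int n)) = 0" if "n \<ge> k" for n
  proof -
    have "falling casimir k (int n) (int k) \<noteq> (0 :: 'a)"
      using that by (simp add: falling_def del: of_int_mult)
    moreover have "0 = (\<Sum>a\<le>k. falling casimir a (int n) (int k) *
        poly (m a) (of_int (int n - 2 * int k + 2 * int a)))"
      using assms[of k "int n"] that by simp
    then have "falling casimir k (int n) (int k) * poly (m k) (of_int (int n)) = 0"
      by (simp add: less lessThan_Suc_atMost[symmetric])
    ultimately show ?thesis by simp
  qed
  then show ?case
    by (intro poly_eq_0_if_eventually_0[of "\<lambda>n. of_int (int n)" k]) (auto simp: inj_def)
qed

section \<open>Invariant power series\<close>

definition inv_series :: "(int \<Rightarrow> int \<Rightarrow> 'a::field_char_0 fps) \<Rightarrow> bool" where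
  "inv_series C \<longleftrightarrow> (\<forall>i. inv_bipoly (\<lambda>n p. fps_nth (C n p) i))"

lemma inv_seriesI: "(\<And>i. inv_bipoly (\<lambda>n p. fps_nth (C n p) i)) \<Longrightarrow> inv_series C"
  by (simp add: inv_series_def)

lemma inv_seriesD: "inv_series C \<Longrightarrow> inv_bipoly (\<lambda>n p. fps_nth (C n p) i)"
  by (simp add: inv_series_def)

lemma inv_series_mult: "inv_series C \<Longrightarrow> inv_series D \<Longrightarrow> inv_series (\<lambda>n p. C n p * D n p)"
  unfolding inv_series_def fps_mult_nth by (intro allI inv_bipoly_sum inv_bipoly_mult) simp_all

lemma inv_series_falling:
  assumes "inv_series C"
  shows "inv_series (falling C a)"
proof (induction a)
  case 0 then show ?case by (simp add: inv_series_def inv_bipoly_const)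
next
  case (Suc a)
  have "inv_series (\<lambda>n p. C n (p - int a))"
    using assms inv_bipoly_shift unfolding inv_series_def by blast
  then show ?case using inv_series_mult[OF Suc] by (simp add: falling_Suc[abs_def])
qed

lemma inv_series_eval1: "inv_series (\<lambda>n p. eval1 P (n - 2 * p + 2 * c))"
  by (rule inv_seriesI) (simp only: eval1_def fps_nth_Abs_fps inv_bipoly_weight)

text \<open>
  Modulo \<open>h\<close> the expansion exists by \<open>inv_bipoly_imp_has_expansion\<close>, and subtracting it leaves an
  invariant remainder divisible by \<open>h\<close>, to which the same step applies.
\<close>

lemma inv_series_expansion:
  fixes C Q :: "int \<Rightarrow> int \<Rightarrow> 'a::field_char_0 fps"
  assumes C: "inv_series C" "\<And>n p. fps_nth (C n p) 0 = casimir n p" "\<And>n. n \<ge> 0 \<Longrightarrow> C n 0 = 0"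
    and Q: "inv_series Q"
  shows "\<exists>M. M \<longlonglongrightarrow> 0 \<and> (\<forall>n k. int k \<le> n \<longrightarrow>
    (\<Sum>a\<le>k. falling C a n (int k) * eval1 (M a) (n - 2 * int k + 2 * int a)) = Q n (int k))"
proof -
  \<comment> \<open>The coefficients \<open>m\<close> are free of h, but the products are those of
    the full series \<open>C\<close>, so subtracting \<open>T\<close> also changes the higher
    coefficients of the remainder.\<close>
  define T where "T N m n p =
    (\<Sum>a<N. falling C a n p * fps_const (poly (m a) (of_int (n - 2 * p + 2 * int a))))"
    for N :: nat and m :: "nat \<Rightarrow> 'a poly" and n p
  have T: "inv_series (T N m)" for N m
  proof (rule inv_seriesI)
    fix i show "inv_bipoly (\<lambda>n p. fps_nth (T N m n p) i)"
      unfolding T_def fps_sum_nth fps_mult_right_const_nth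
      by (intro inv_bipoly_sum inv_bipoly_mult inv_bipoly_weight inv_seriesD
          inv_series_falling C)
  qed
  have falling0: "fps_nth (falling C a n p) 0 = falling casimir a n p" for a n p
    by (induction a) (simp_all add: falling_Suc C(2) del: of_int_mult)
  have "\<exists>N m. (\<forall>a\<ge>N. m a = 0) \<and> (\<forall>n p. fps_nth (R n p) 0 = fps_nth (T N m n p) 0)"
    if "inv_series R" for R
    using inv_bipoly_imp_has_expansion[OF inv_seriesD[OF that, of 0]]
    unfolding has_expansion_def T_def by (simp add: fps_sum_nth falling0)
  then obtain N m where Nm: "\<And>R a. inv_series R \<Longrightarrow> a \<ge> N R \<Longrightarrow> m R a = 0"
    "\<And>R n p. inv_series R \<Longrightarrow> fps_nth (R n p) 0 = fps_nth (T (N R) (m R) n p) 0"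
    by metis
  define next_R where "next_R R n p = fps_shift 1 (R n p - T (N R) (m R) n p)"
    for R :: "int \<Rightarrow> int \<Rightarrow> 'a fps" and n p
  define R where "R i = (next_R ^^ i) Q" for i
  have R: "inv_series (R i)" for i
  proof (induction i)
    case 0 then show ?case by (simp add: R_def Q)
  next
    case (Suc i)
    show ?case
    proof (rule inv_seriesI)
      fix j
      have "inv_bipoly (\<lambda>n p. fps_nth (R i n p) (Suc j) - fps_nth (T (N (R i)) (m (R i)) n p) (Suc j))"
        by (intro inv_bipoly_diff inv_seriesD Suc T)
      then show "inv_bipoly (\<lambda>n p. fps_nth (R (Suc i) n p) j)"
        by (simp add: R_def next_R_def)
    qed
  qed
  have next_R: "R (Suc i) n p = next_R (R i) n p" for i n p
    by (simp add: R_def)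
  have R_Suc: "R i n p = T (N (R i)) (m (R i)) n p + fps_X * R (Suc i) n p" for i n p
  proof -
    have "R i n p - T (N (R i)) (m (R i)) n p = fps_X * R (Suc i) n p"
    proof (rule fps_ext)
      fix j show "fps_nth (R i n p - T (N (R i)) (m (R i)) n p) j = fps_nth (fps_X * R (Suc i) n p) j"
        by (cases j) (simp_all add: Nm(2)[OF R] next_R next_R_def)
    qed
    then show ?thesis by (simp add: algebra_simps)
  qed
  have Q_eq: "Q n p = (\<Sum>i<K. fps_X ^ i * T (N (R i)) (m (R i)) n p) + fps_X ^ K * R K n p" for K n p
  proof (induction K)
    case 0 then show ?case by (simp add: R_def)
  next
    case (Suc K)
    then show ?case by (subst (asm) R_Suc) (simp add: algebra_simps)
  qed
  \<comment> \<open>The coefficient of h^i comes from the i-th remainder. It vanishes for a >=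
    \<open>N (R i)\<close>, which is h-adic convergence read coefficientwise.\<close>
  define M where "M a = Abs_fps (\<lambda>i. m (R i) a)" for a
  have "M \<longlonglongrightarrow> 0"
    unfolding tendsto_fps_iff
  proof
    fix i show "\<forall>\<^sub>F a in sequentially. fps_nth (M a) i = fps_nth 0 i"
      unfolding eventually_sequentially using Nm(1)[OF R] by (auto simp: M_def)
  qed
  moreover have "(\<Sum>a\<le>k. falling C a n (int k) * eval1 (M a) (n - 2 * int k + 2 * int a)) = Q n (int k)"
    if "int k \<le> n" for n k
  proof (rule fps_ext)
    fix i
    let ?w = "\<lambda>a. n - 2 * int k + 2 * int a"
    have C0: "C n 0 = 0" using that by (intro C) simp
    have T_eq: "T (N (R j)) (m (R j)) n (int k) =
        (\<Sum>a\<le>k. falling C a n (int k) * fps_const (poly (m (R j) a) (of_int (?w a))))" for j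
    proof -
      let ?f = "\<lambda>a. falling C a n (int k) * fps_const (poly (m (R j) a) (of_int (?w a)))"
      have "sum ?f {..<N (R j)} = sum ?f {..N (R j) + k}"
        by (rule sum.mono_neutral_left) (use Nm(1)[OF R] in auto)
      also have "\<dots> = sum ?f {..k}"
        by (rule sum.mono_neutral_right) (auto simp: falling_eq_0[of C, OF C0])
      finally show ?thesis by (simp add: T_def)
    qed
    \<comment> \<open>After i + 1 steps the remainder is divisible by h^(i+1) and does not reach the
      coefficient of h^i.\<close>
    have "fps_nth (Q n (int k)) i = (\<Sum>j\<le>i. fps_nth (T (N (R j)) (m (R j)) n (int k)) (i - j))"
      by (subst Q_eq[of _ _ "Suc i"])
        (simp add: fps_sum_nth fps_X_power_mult_nth lessThan_Suc_atMost del: power_Suc)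
    also have "\<dots> = (\<Sum>j\<le>i. \<Sum>a\<le>k. fps_nth (falling C a n (int k)) (i - j) *
        poly (m (R j) a) (of_int (?w a)))"
      by (simp only: T_eq fps_sum_nth fps_mult_right_const_nth)
    also have "\<dots> = (\<Sum>a\<le>k. \<Sum>j\<le>i. fps_nth (falling C a n (int k)) (i - j) *
        poly (m (R j) a) (of_int (?w a)))"
      by (rule sum.swap)
    also have "\<dots> = (\<Sum>a\<le>k. fps_nth (eval1 (M a) (?w a) * falling C a n (int k)) i)"
      by (simp only: fps_mult_nth eval1_def M_def fps_nth_Abs_fps atLeast0AtMost
          mult.commute[of "fps_nth (falling C _ _ _) _"])
    finally show "fps_nth (\<Sum>a\<le>k. falling C a n (int k) * eval1 (M a) (?w a)) i
        = fps_nth (Q n (int k)) i"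
      by (simp add: fps_sum_nth mult.commute)
  qed
  ultimately show ?thesis by blast
qed

section \<open>The GQE equation\<close>

lemma GQE_left_eq:
  assumes "int p \<le> n"
  shows "GQE_left \<psi> M p n =
    (\<Sum>a\<le>p. falling (\<lambda>n p. GQE_N \<psi> p n) a n (int p) * eval1 (M a) (n - 2 * int p + 2 * int a))"
proof -
  have "(\<Prod>k = p - a + 1..p. cong_class \<psi> (nat n, k)) = falling (\<lambda>n p. GQE_N \<psi> p n) a n (int p)"
    if "a \<le> p" for a
    unfolding falling_def
    by (rule prod.reindex_bij_witness[of _ "\<lambda>j. p - j" "\<lambda>k. p - k"])
      (use that assms in \<open>auto simp: GQE_N_def nat_diff_distrib' of_nat_diff\<close>)
  then show ?thesis using assms by (simp add: GQE_left_def atLeast0AtMost)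
qed

text \<open>For d <= 0 the case p < d never occurs, and p > n forces p - d > n, so that both sides
  are zero there.\<close>

lemma GQE_solution_iff:
  assumes "d \<le> 0"
  shows "GQE_solution d \<psi>\<^sub>1 \<psi>\<^sub>2 M \<longleftrightarrow> M \<longlonglongrightarrow> 0 \<and> (\<forall>n p. int p \<le> n \<longrightarrow>
    (\<Sum>a\<le>p. falling (\<lambda>n p. GQE_N \<psi>\<^sub>1 p n) a n (int p) * eval1 (M a) (n - 2 * int p + 2 * int a))
      = GQE_N \<psi>\<^sub>2 (int p - d) n)"
proof -
  have "GQE_left \<psi>\<^sub>1 M p n = GQE_right d \<psi>\<^sub>2 p n \<longleftrightarrow> (int p \<le> n \<longrightarrow>
    (\<Sum>a\<le>p. falling (\<lambda>n p. GQE_N \<psi>\<^sub>1 p n) a n (int p) * eval1 (M a) (n - 2 * int p + 2 * int a))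
      = GQE_N \<psi>\<^sub>2 (int p - d) n)" for p n
  proof (cases "int p \<le> n")
    case True
    then show ?thesis using assms by (simp add: GQE_left_eq GQE_right_def)
  next
    case False
    then show ?thesis using assms by (simp add: GQE_left_def GQE_right_def GQE_N_def)
  qed
  then show ?thesis unfolding GQE_solution_def by blast
qed

text \<open>The zero extension preserves the axiom because p (n - p + 1) vanishes on both boundary
  lines.\<close>

lemma deformation_axiomD:
  assumes "deformation_axiom \<psi>" "0 \<le> p" "p \<le> n + 1"
  shows "fps_nth (GQE_N \<psi> p n) 0 = casimir n p"
proof (cases "1 \<le> p \<and> p \<le> n")
  case True
  then have "(nat n, nat p) \<in> E_set" by (auto simp: E_set_def)
  then have "fps_nth (cong_class \<psi> (nat n, nat p)) 0 = of_nat (nat p * (nat n - nat p + 1))"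
    using assms(1) unfolding deformation_axiom_def by blast
  also have "\<dots> = of_int (int (nat p * (nat n - nat p + 1)))" by (simp only: of_int_of_nat_eq)
  also have "int (nat p * (nat n - nat p + 1)) = p * (n - p + 1)"
    using True by (simp add: nat_diff_distrib[symmetric] algebra_simps)
  finally show ?thesis using True by (simp add: GQE_N_def)
next
  case False
  then have "p = 0 \<or> p = n + 1" using assms by linarith
  then show ?thesis by (auto simp: GQE_N_def)
qed

section \<open>Admissibility as invariance of the extended congruence class\<close>

text \<open>
  \<open>GQE_N \<psi>\<close> extends the congruence class by zero to the boundary lines \<open>p = 0\<close> and \<open>p = n + 1\<close>.
  The second one is the quotient axiom, and the reflection maps it to the first one.
\<close>

lemma h_admissible_iff:
  "h_admissible \<psi> \<longleftrightarrow> deformation_axiom \<psi> \<and>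
    (\<exists>C. inv_series C \<and> (\<forall>n p. 0 \<le> n \<longrightarrow> 0 \<le> p \<longrightarrow> p \<le> n + 1 \<longrightarrow> C n p = GQE_N \<psi> p n))"
proof (intro iffI conjI)
  assume "h_admissible \<psi>"
  then obtain P where P: "represents P \<psi>" "quotient_axiom P" "verma_axiom P"
    unfolding h_admissible_def by blast
  have bi: "bipoly (\<lambda>n p. fps_nth (eval2 P n p) i)" for i
    by (rule bipolyI[of _ "fps_nth P i"]) (simp add: eval2_def)
  have inv: "inv_bipoly (\<lambda>n p. fps_nth (eval2 P n p) i)" for i
    by (rule inv_bipolyI[OF bi]) (use P(3) in \<open>simp add: verma_axiom_def\<close>)
  have top: "eval2 P n (n + 1) = 0" if "n \<ge> 0" for n
    using P(2) that unfolding quotient_axiom_def by (metis nonneg_int_cases)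
  have top': "fps_nth (eval2 P n (n + 1)) i = 0" for n i
  proof (rule bipoly_eq_0[where F = "\<lambda>n p. fps_nth (eval2 P n (n + 1)) i"])
    show "bipoly (\<lambda>n p. fps_nth (eval2 P n (n + 1)) i)"
      using bi by (rule bipoly_compose) (simp_all add: bipoly_intros)
  qed (simp add: top)
  \<comment> \<open>The reflection sends (n, 0) to (-n-2, -n-1), a point of the line p = n + 1;
    hence \<open>top'\<close> is needed for all integers n.\<close>
  have bot: "eval2 P n 0 = 0" for n
  proof (rule fps_ext)
    fix i
    have "- n - 2 + 1 = 0 - n - 1" by simp
    then show "fps_nth (eval2 P n 0) i = fps_nth 0 i"
      using inv_bipoly_reflect[OF inv[of i], of n 0] top'[of "- n - 2" i] by (simp only: fps_zero_nth)
  qed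
  have "eval2 P n p = GQE_N \<psi> p n" if "0 \<le> n" "0 \<le> p" "p \<le> n + 1" for n p
  proof (cases "1 \<le> p \<and> p \<le> n")
    case True
    then have "(nat n, nat p) \<in> E_set" by (auto simp: E_set_def)
    then have "cong_class \<psi> (nat n, nat p) = eval2 P (int (nat n)) (int (nat p))"
      using P(1) unfolding represents_def by blast
    then show ?thesis using True by (simp add: GQE_N_def)
  next
    case False
    then have "p = 0 \<or> p = n + 1" using that by linarith
    then show ?thesis using top[OF that(1)] bot by (auto simp: GQE_N_def)
  qed
  then show "\<exists>C. inv_series C \<and> (\<forall>n p. 0 \<le> n \<longrightarrow> 0 \<le> p \<longrightarrow> p \<le> n + 1 \<longrightarrow> C n p = GQE_N \<psi> p n)"
    using inv by (intro exI[of _ "eval2 P"]) (simp add: inv_series_def)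
next
  assume *: "deformation_axiom \<psi> \<and>
    (\<exists>C. inv_series C \<and> (\<forall>n p. 0 \<le> n \<longrightarrow> 0 \<le> p \<longrightarrow> p \<le> n + 1 \<longrightarrow> C n p = GQE_N \<psi> p n))"
  then obtain C where C: "inv_series C"
    "\<And>n p. 0 \<le> n \<Longrightarrow> 0 \<le> p \<Longrightarrow> p \<le> n + 1 \<Longrightarrow> C n p = GQE_N \<psi> p n" by blast
  have "\<forall>i. \<exists>P. \<forall>n p. fps_nth (C n p) i = poly (poly P [:of_int p:]) (of_int n)"
    using inv_bipoly_imp_bipoly[OF inv_seriesD[OF C(1)]] unfolding bipoly_def by blast
  from choice[OF this] obtain P where
    P: "\<And>i n p. fps_nth (C n p) i = poly (poly (P i) [:of_int p:]) (of_int n)"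
    by blast
  have CP: "eval2 (Abs_fps P) n p = C n p" for n p
    by (rule fps_ext) (simp add: eval2_def P)
  have "represents (Abs_fps P) \<psi>"
    unfolding represents_def CP by (auto simp: E_set_def C(2) GQE_N_def)
  moreover have "quotient_axiom (Abs_fps P)"
    unfolding quotient_axiom_def CP by (auto simp: C(2) GQE_N_def)
  moreover have "verma_axiom (Abs_fps P)"
    unfolding verma_axiom_def CP
  proof (intro allI impI fps_ext)
    fix n k :: int and i
    show "fps_nth (C (- n - 2) k) i = fps_nth (C n (n + k + 1)) i"
      using inv_bipoly_reflect[OF inv_seriesD[OF C(1), of i], of n "n + k + 1"] by simp
  qed
  ultimately show "h_admissible \<psi>" using * unfolding h_admissible_def by blast
qed (simp add: h_admissible_def)

section \<open>Expansions over an admissible colouring\<close>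

lemma h_admissible_imp_expansion:
  assumes "h_admissible \<psi>" "inv_series Q"
  shows "\<exists>M. M \<longlonglongrightarrow> 0 \<and> (\<forall>n p. int p \<le> n \<longrightarrow>
    (\<Sum>a\<le>p. falling (\<lambda>n p. GQE_N \<psi> p n) a n (int p) * eval1 (M a) (n - 2 * int p + 2 * int a))
      = Q n (int p))"
proof -
  obtain C where C: "inv_series C"
    "\<And>n p. 0 \<le> n \<Longrightarrow> 0 \<le> p \<Longrightarrow> p \<le> n + 1 \<Longrightarrow> C n p = GQE_N \<psi> p n"
    and def: "deformation_axiom \<psi>"
    using assms(1) unfolding h_admissible_iff by blast
  \<comment> \<open>The deformation axiom gives this on the triangle only; both sides are
    polynomial, so it holds everywhere.\<close>
  have "fps_nth (C n p) 0 = casimir n p" for n p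
  proof (rule bipoly_eqI[where F = "\<lambda>n p. fps_nth (C n p) 0" and G = casimir])
    show "bipoly (\<lambda>n p. fps_nth (C n p) 0)"
      by (intro inv_bipoly_imp_bipoly inv_seriesD C)
    show "bipoly casimir" by (simp add: bipoly_intros)
    show "fps_nth (C n p) 0 = casimir n p" if "1 \<le> p" "p \<le> n" for n p
      using that by (subst C(2)) (simp_all only: deformation_axiomD[OF def])
  qed
  moreover have "C n 0 = 0" if "n \<ge> 0" for n
    using that by (simp add: C(2) GQE_N_def)
  ultimately obtain M where M: "M \<longlonglongrightarrow> 0" "\<And>n p. int p \<le> n \<Longrightarrow>
      (\<Sum>a\<le>p. falling C a n (int p) * eval1 (M a) (n - 2 * int p + 2 * int a)) = Q n (int p)"
    using inv_series_expansion[OF C(1) _ _ assms(2)] by blast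
  have "falling C a n (int p) = falling (\<lambda>n p. GQE_N \<psi> p n) a n (int p)"
    if "int p \<le> n" "a \<le> p" for a n p
    unfolding falling_def by (rule prod.cong) (use that in \<open>auto intro!: C(2)\<close>)
  then have "(\<Sum>a\<le>p. falling (\<lambda>n p. GQE_N \<psi> p n) a n (int p) *
      eval1 (M a) (n - 2 * int p + 2 * int a)) = Q n (int p)" if "int p \<le> n" for n p
    unfolding M(2)[OF that, symmetric] using that by (intro sum.cong) simp_all
  then show ?thesis using M(1) by blast
qed

section \<open>From a solution to admissibility\<close>

lemma fps_mult_nth_if_subdegree_ge:
  fixes f g :: "'b::semiring_0 fps"
  assumes "\<And>i. i < m \<Longrightarrow> fps_nth f i = 0"
  shows "fps_nth (f * g) m = fps_nth f m * fps_nth g 0"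
proof -
  have "fps_nth (f * g) m = (\<Sum>i=0..m. fps_nth f i * fps_nth g (m - i))" by (rule fps_mult_nth)
  also have "\<dots> = (\<Sum>i\<in>{m}. fps_nth f i * fps_nth g (m - i))"
    by (rule sum.mono_neutral_right) (auto simp: assms)
  finally show ?thesis by simp
qed

lemma falling_nth_cong:
  fixes C D :: "int \<Rightarrow> int \<Rightarrow> 'b::comm_semiring_1 fps"
  assumes "\<And>i j. i < m \<Longrightarrow> j < a \<Longrightarrow> fps_nth (C n (p - int j)) i = fps_nth (D n (p - int j)) i"
    and "i < m"
  shows "fps_nth (falling C a n p) i = fps_nth (falling D a n p) i"
  using assms
proof (induction a arbitrary: i)
  case (Suc a)
  then show ?case by (auto simp: falling_Suc fps_mult_nth intro!: sum.cong arg_cong2[where f = "(*)"])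
qed simp

text \<open>Modulo h the right side is (p+1)(n-p) = (n-2p) + p(n-p+1). This is an expansion with
  coefficients u and 1 at a = 0 and a = 1, and expansions are unique.\<close>

lemma GQE_solution_leading_terms:
  assumes def: "deformation_axiom \<psi>" and sol: "GQE_solution (-1) \<psi> \<psi> M"
  shows "fps_nth (M a) 0 = (if a = 0 then [:0, 1:] else if a = 1 then 1 else 0)"
proof -
  define m where "m a = (if a = 0 then [:0, 1:] else if a = 1 then 1 else 0 :: 'a poly)" for a :: nat
  have eq: "(\<Sum>a\<le>p. falling (\<lambda>n p. GQE_N \<psi> p n) a n (int p) * eval1 (M a) (n - 2 * int p + 2 * int a))
      = GQE_N \<psi> (int p + 1) n" if "int p \<le> n" for n p
    using sol that by (subst (asm) GQE_solution_iff) simp_all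
  have falling0: "fps_nth (falling (\<lambda>n p. GQE_N \<psi> p n) a n (int p)) 0 = falling casimir a n (int p)"
    if "a \<le> p" "int p \<le> n" for a n p
    using that
    by (induction a) (simp_all add: falling_Suc deformation_axiomD[OF def] del: of_int_mult)
  have "fps_nth (M a) 0 - m a = 0"
  proof (rule expansion_unique[of "\<lambda>a. fps_nth (M a) 0 - m a"])
    fix n and k :: nat assume k: "int k \<le> n"
    let ?w = "\<lambda>a. of_int (n - 2 * int k + 2 * int a) :: 'a"
    have "(\<Sum>a\<le>k. falling casimir a n (int k) * poly (fps_nth (M a) 0) (?w a))
        = fps_nth (GQE_N \<psi> (int k + 1) n) 0"
      unfolding eq[OF k, symmetric] fps_sum_nth fps_mult_nth_0
      by (rule sum.cong) (simp_all only: falling0 k eval1_def fps_nth_Abs_fps atMost_iff)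
    also have "\<dots> = of_int ((int k + 1) * (n - int k))"
      using k by (subst deformation_axiomD[OF def]) simp_all
    also have "\<dots> = of_int (n - 2 * int k) + casimir n (int k)"
      by (simp add: algebra_simps)
    also have "\<dots> = (\<Sum>a\<le>k. falling casimir a n (int k) * poly (m a) (?w a))"
    proof (cases k)
      case 0 then show ?thesis by (simp add: m_def)
    next
      case (Suc l)
      have "(\<Sum>a\<le>k. falling casimir a n (int k) * poly (m a) (?w a))
          = (\<Sum>a\<in>{0, 1}. falling casimir a n (int k) * poly (m a) (?w a))"
        by (rule sum.mono_neutral_right) (auto simp: m_def Suc)
      then show ?thesis by (simp add: m_def falling_def)
    qed
    finally show "(\<Sum>a\<le>k. falling casimir a n (int k) * poly (fps_nth (M a) 0 - m a) (?w a)) = 0"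
      by (simp only: poly_diff right_diff_distrib sum_subtractf diff_self)
  qed
  then show ?thesis by (simp add: m_def)
qed

text \<open>
  Since \<open>M\<^sub>1 = 1\<close> and \<open>M\<^sub>a = 0\<close> modulo \<open>h\<close> for \<open>a \<ge> 2\<close>, the coefficient of \<open>h^m\<close> in the equation
  reads \<open>c\<^sub>m(n, p+1) = c\<^sub>m(n, p) + D(n, p)\<close>, where \<open>D\<close> only involves lower coefficients of \<open>c\<close>.
\<close>

lemma GQE_solution_imp_coeff_invariant:
  fixes \<psi> :: "'a::field_char_0 colouring"
  assumes def: "deformation_axiom \<psi>" and sol: "GQE_solution (-1) \<psi> \<psi> M"
  shows "\<exists>F. inv_bipoly F \<and> (\<forall>n p. 0 \<le> n \<longrightarrow> 0 \<le> p \<longrightarrow> p \<le> n + 1 \<longrightarrow> F n p = fps_nth (GQE_N \<psi> p n) m)"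
proof (induction m rule: less_induct)
  case (less m)
  let ?c = "\<lambda>n p. GQE_N \<psi> p n"
  let ?e = "\<lambda>a n p. eval1 (M a) (n - 2 * p + 2 * int a)"
  have lim: "M \<longlonglongrightarrow> 0" using sol by (simp add: GQE_solution_def)
  have eq: "(\<Sum>a\<le>p. falling ?c a n (int p) * ?e a n (int p)) = ?c n (int p + 1)" if "int p \<le> n" for n p
    using sol that by (subst (asm) GQE_solution_iff) simp_all
  show ?case
  proof (cases "m = 0")
    case True
    have "inv_bipoly casimir" unfolding inv_bipoly_def using bipoly_snd by blast
    then show ?thesis using True deformation_axiomD[OF def, symmetric] by blast
  next
    case False
    have "\<forall>i\<in>{..<m}. \<exists>F. inv_bipoly F \<and>
        (\<forall>n p. 0 \<le> n \<longrightarrow> 0 \<le> p \<longrightarrow> p \<le> n + 1 \<longrightarrow> F n p = fps_nth (?c n p) i)"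
      using less by simp
    from bchoice[OF this] obtain F where F: "\<And>i. i < m \<Longrightarrow> inv_bipoly (F i)"
      "\<And>i n p. i < m \<Longrightarrow> 0 \<le> n \<Longrightarrow> 0 \<le> p \<Longrightarrow> p \<le> n + 1 \<Longrightarrow> F i n p = fps_nth (?c n p) i"
      by auto
    \<comment> \<open>The known coefficients below h^m, cut off there, so that falling products of
      \<open>?c\<close> and \<open>C\<close> agree below h^m.\<close>
    define C where "C n p = Abs_fps (\<lambda>i. if i < m then F i n p else 0)" for n p
    have C: "inv_series C"
    proof (rule inv_seriesI)
      fix i show "inv_bipoly (\<lambda>n p. fps_nth (C n p) i)"
        by (cases "i < m") (simp_all add: C_def F(1) inv_bipoly_const)
    qed
    have C0: "C n 0 = 0" if "n \<ge> 0" for n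
      by (rule fps_ext) (use that in \<open>simp add: C_def F(2) GQE_N_def\<close>)
    have "\<forall>\<^sub>F a in sequentially. \<forall>i\<in>{..m}. fps_nth (M a) i = 0"
      using lim by (intro eventually_ball_finite) (simp_all add: tendsto_fps_iff)
    then obtain N where N: "\<And>a i. a \<ge> N \<Longrightarrow> i \<le> m \<Longrightarrow> fps_nth (M a) i = 0"
      unfolding eventually_sequentially by auto
    \<comment> \<open>By convergence finitely many a contribute up to h^m, so \<open>D\<close> is
      one polynomial function valid for all n and p.\<close>
    define D where "D n p = (\<Sum>a<N. fps_nth (falling C a n p * ?e a n p) m)" for n p
    have D: "inv_bipoly D"
      unfolding D_def
      by (intro inv_bipoly_sum inv_seriesD inv_series_mult inv_series_eval1
          inv_series_falling C)
    have D_eq: "D n (int k) = (\<Sum>a\<le>k. fps_nth (falling C a n (int k) * ?e a n (int k)) m)"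
      if "n \<ge> 0" for n k
    proof -
      let ?f = "\<lambda>a. fps_nth (falling C a n (int k) * ?e a n (int k)) m"
      have "sum ?f {..<N} = sum ?f {..N + k}"
        by (rule sum.mono_neutral_left) (auto simp: N fps_mult_nth eval1_def intro!: sum.neutral)
      also have "\<dots> = sum ?f {..k}"
        by (rule sum.mono_neutral_right) (auto simp: falling_eq_0[of C, OF C0[OF that]])
      finally show ?thesis by (simp add: D_def)
    qed
    have rec: "fps_nth (?c n (int k + 1)) m = fps_nth (?c n (int k)) m + D n (int k)"
      if k: "int k \<le> n" for n k
    proof -
      \<comment> \<open>The two products differ by a multiple of h^m, so only \<open>M a\<close>
        modulo h matters. For a = 0 both products are 1; for a = 1 the unknown coefficient appears
        with factor 1; for a >= 2 the factor is 0.\<close>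
      have term_eq: "fps_nth (falling ?c a n (int k) * ?e a n (int k)) m
          = fps_nth (falling C a n (int k) * ?e a n (int k)) m
            + (if a = 1 then fps_nth (?c n (int k)) m else 0)" if "a \<le> k" for a
      proof -
        let ?f = "falling ?c a n (int k) - falling C a n (int k)"
        have "fps_nth (falling ?c a n (int k)) i = fps_nth (falling C a n (int k)) i"
          if "i < m" for i
          using that k \<open>a \<le> k\<close> by (intro falling_nth_cong[of m]) (auto simp: C_def F(2))
        then have "fps_nth (?f * ?e a n (int k)) m
            = fps_nth ?f m * fps_nth (?e a n (int k)) 0"
          by (intro fps_mult_nth_if_subdegree_ge) simp
        also have "\<dots> = (if a = 1 then fps_nth (?c n (int k)) m else 0)"
          by (auto simp: eval1_def GQE_solution_leading_terms[OF def sol] falling_def C_def)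
        finally show ?thesis by (simp add: left_diff_distrib algebra_simps)
      qed
      have "fps_nth (?c n (int k + 1)) m
          = (\<Sum>a\<le>k. fps_nth (falling ?c a n (int k) * ?e a n (int k)) m)"
        by (simp only: eq[OF k, symmetric] fps_sum_nth)
      also have "\<dots> = (\<Sum>a\<le>k. fps_nth (falling C a n (int k) * ?e a n (int k)) m
            + (if a = 1 then fps_nth (?c n (int k)) m else 0))"
        by (rule sum.cong) (simp_all only: term_eq atMost_iff)
      also have "\<dots> = D n (int k) + (if 1 \<le> k then fps_nth (?c n (int k)) m else 0)"
        using k by (simp add: sum.distrib D_eq)
      \<comment> \<open>For k = 0 the term a = 1 is absent, but then the extended class is
        zero.\<close>
      also have "(if 1 \<le> k then fps_nth (?c n (int k)) m else 0) = fps_nth (?c n (int k)) m"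
        by (simp add: GQE_N_def)
      finally show ?thesis by simp
    qed
    obtain S where S: "bipoly S" "\<And>n. S n 0 = 0" "\<And>n p. S n (p + 1) = S n p + D n p"
      using bipoly_antidifference[OF inv_bipoly_imp_bipoly[OF D]] by blast
    have Sc: "S n (int k) = fps_nth (?c n (int k)) m" if "n \<ge> 0" "int k \<le> n + 1" for n k
      using that(2)
    proof (induction k)
      case 0 then show ?case by (simp add: S(2) GQE_N_def)
    next
      case (Suc k)
      then show ?case using S(3)[of n "int k"] rec[of k n] by (simp add: add.commute)
    qed
    have Sc': "S n p = fps_nth (?c n p) m" if "0 \<le> n" "0 \<le> p" "p \<le> n + 1" for n p
      using Sc[of n "nat p"] that by simp
    \<comment> \<open>The zero extension at p = n + 1 supplies the vanishing on the upper boundary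
      line.\<close>
    have "inv_bipoly S"
      using D S by (rule inv_bipoly_antidifference) (simp add: Sc' GQE_N_def)
    then show ?thesis using Sc' by blast
  qed
qed

lemma GQE_solution_imp_h_admissible:
  assumes def: "deformation_axiom \<psi>" and sol: "GQE_solution (-1) \<psi> \<psi> M"
  shows "h_admissible \<psi>"
proof -
  have "\<forall>i. \<exists>F. inv_bipoly F \<and>
      (\<forall>n p. 0 \<le> n \<longrightarrow> 0 \<le> p \<longrightarrow> p \<le> n + 1 \<longrightarrow> F n p = fps_nth (GQE_N \<psi> p n) i)"
    using GQE_solution_imp_coeff_invariant[OF assms] by blast
  from choice[OF this] obtain F where F: "\<And>i. inv_bipoly (F i)"
    "\<And>i n p. 0 \<le> n \<Longrightarrow> 0 \<le> p \<Longrightarrow> p \<le> n + 1 \<Longrightarrow> F i n p = fps_nth (GQE_N \<psi> p n) i"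
    by auto
  let ?C = "\<lambda>n p. Abs_fps (\<lambda>i. F i n p)"
  have "inv_series ?C" by (rule inv_seriesI) (simp add: F(1))
  moreover have "?C n p = GQE_N \<psi> p n" if "0 \<le> n" "0 \<le> p" "p \<le> n + 1" for n p
    by (rule fps_ext) (simp add: F(2) that)
  ultimately show ?thesis unfolding h_admissible_iff using def by blast
qed

section \<open>Solutions from admissibility, and the theorem\<close>

lemma h_admissible_imp_GQE_solution:
  assumes "h_admissible \<psi>\<^sub>1" "h_admissible \<psi>\<^sub>2" "d \<in> {-1, 0}"
  shows "\<exists>M. GQE_solution d \<psi>\<^sub>1 \<psi>\<^sub>2 M"
proof -
  obtain C where C: "inv_series C"
    "\<And>n p. 0 \<le> n \<Longrightarrow> 0 \<le> p \<Longrightarrow> p \<le> n + 1 \<Longrightarrow> C n p = GQE_N \<psi>\<^sub>2 p n"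
    using assms(2) unfolding h_admissible_iff by blast
  have "inv_series (\<lambda>n p. C n (p - d))"
    using C(1) inv_bipoly_shift unfolding inv_series_def by blast
  from h_admissible_imp_expansion[OF assms(1) this] obtain M where M: "M \<longlonglongrightarrow> 0"
    "\<And>n p. int p \<le> n \<Longrightarrow> (\<Sum>a\<le>p. falling (\<lambda>n p. GQE_N \<psi>\<^sub>1 p n) a n (int p) *
        eval1 (M a) (n - 2 * int p + 2 * int a)) = C n (int p - d)"
    by blast
  \<comment> \<open>For d = -1 and p = n the argument is n + 1, just inside the range where
    \<open>C\<close> agrees with the zero extension.\<close>
  have "C n (int p - d) = GQE_N \<psi>\<^sub>2 (int p - d) n" if "int p \<le> n" for n p
    using assms(3) that by (intro C(2)) auto
  then have "GQE_solution d \<psi>\<^sub>1 \<psi>\<^sub>2 M"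
    using assms(3) M by (subst GQE_solution_iff) auto
  then show ?thesis by blast
qed

theorem theoremA6:
  fixes \<psi>\<^sub>1 \<psi>\<^sub>2 :: "'a::field_char_0 colouring"
  assumes "deformation_axiom \<psi>\<^sub>1" and "deformation_axiom \<psi>\<^sub>2"
  shows "((\<exists>M. GQE_solution (-1) \<psi>\<^sub>1 \<psi>\<^sub>1 M) \<longleftrightarrow> h_admissible \<psi>\<^sub>1) \<and>
         (h_admissible \<psi>\<^sub>1 \<and> h_admissible \<psi>\<^sub>2 \<longrightarrow> (\<exists>M. GQE_solution 0 \<psi>\<^sub>1 \<psi>\<^sub>2 M))"
  using GQE_solution_imp_h_admissible[OF assms(1)] h_admissible_imp_GQE_solution by blast

end
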